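(* Let $A_k=\{a_1,\dots,a_k\}$ with $1=a_1<a_2<\dots<a_k$ integers, let $h_0$ be the smallest positive integer $h$ with $n(h)\ge a_k$, and let $h\ge h_0+1$ be an integer. Let $x$ be an $h$-gap with $x_h=c_{k-1}a_{k-1}+\dots+c_1a_1$, where the $c_i$ are nonnegative integers with $\sum_{i=1}^{k-1}c_i\le h$. Then for every $i\in\{1,\dots,k-1\}$ with $c_i>0$, the integer $x+(a_k-a_i)$ is an $(h-1)$-gap.
   Context: For an integer $h\ge 0$, an integer $y\ge 0$ has an $h$-representation if $y=\sum_{i=1}^k c_ia_i$ with nonnegative integers $c_i$ and $\sum_i c_i\le h$. The $h$-range $n(h)$ is the largest integer $n$ such that every integer $0\le y\le n$ has an $h$-representation. For an integer $x$ and integer $h$, put $x_h=x+(h-(h_0-1))a_k$. For an integer $m\ge h_0$, an integer $x>n(h_0-1)$ is called an $m$-gap if $x_h$ has no $h$-representation for every integer $h$ with $h_0-1\le h<m$, but $x_m$ has an $m$-representation. *)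

theory Defs
  imports Main
begin

text \<open>
  The set of integers \<open>1 = a 1 < a 2 < \<dots> < a k\<close> is given by the values of
  \<open>a\<close> on \<open>{1..k}\<close>; values outside this interval are never used.
\<close>

definition is_basis :: "(nat \<Rightarrow> nat) \<Rightarrow> nat \<Rightarrow> bool" where
  "is_basis a k \<longleftrightarrow> 1 \<le> k \<and> a 1 = 1 \<and> strict_mono_on {1..k} a"

definition has_rep :: "(nat \<Rightarrow> nat) \<Rightarrow> nat \<Rightarrow> nat \<Rightarrow> int \<Rightarrow> bool" where
  "has_rep a k h y \<longleftrightarrow>
     (\<exists>c :: nat \<Rightarrow> nat. y = (\<Sum>i=1..k. int (c i) * int (a i)) \<and> (\<Sum>i=1..k. c i) \<le> h)"

definition h_range :: "(nat \<Rightarrow> nat) \<Rightarrow> nat \<Rightarrow> nat \<Rightarrow> nat" where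
  "h_range a k h = (GREATEST n. \<forall>y\<le>n. has_rep a k h (int y))"

definition h_zero :: "(nat \<Rightarrow> nat) \<Rightarrow> nat \<Rightarrow> nat" where
  "h_zero a k = (LEAST h. 0 < h \<and> a k \<le> h_range a k h)"

definition shift :: "(nat \<Rightarrow> nat) \<Rightarrow> nat \<Rightarrow> int \<Rightarrow> int \<Rightarrow> int" where
  "shift a k x h = x + (h - (int (h_zero a k) - 1)) * int (a k)"

text \<open>
  The truncated subtraction \<open>h_zero a k - 1\<close> on \<open>nat\<close> is harmless: \<open>h_zero a k\<close> is
  positive for every basis (lemma \<open>h_zero_properties\<close> below).
\<close>

definition is_gap :: "(nat \<Rightarrow> nat) \<Rightarrow> nat \<Rightarrow> nat \<Rightarrow> int \<Rightarrow> bool" where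
  "is_gap a k m x \<longleftrightarrow>
     h_zero a k \<le> m \<and>
     int (h_range a k (h_zero a k - 1)) < x \<and>
     (\<forall>h. h_zero a k - 1 \<le> h \<and> h < m \<longrightarrow> \<not> has_rep a k h (shift a k x (int h))) \<and>
     has_rep a k m (shift a k x (int m))"

text \<open>The maximum and the minimum in the definitions above exist.\<close>

lemma has_rep_le:
  assumes "is_basis a k" "has_rep a k h y"
  shows "y \<le> int (h * a k)"
proof -
  obtain c :: "nat \<Rightarrow> nat" where c: "y = (\<Sum>i=1..k. int (c i) * int (a i))" "(\<Sum>i=1..k. c i) \<le> h"
    using assms(2) by (auto simp: has_rep_def)
  have le: "a i \<le> a k" if "i \<in> {1..k}" for i
    using assms(1) that strict_mono_on_leD[of "{1..k}" a i k] by (auto simp: is_basis_def)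
  have "y = int (\<Sum>i=1..k. c i * a i)" using c(1) by simp
  also have "(\<Sum>i=1..k. c i * a i) \<le> (\<Sum>i=1..k. c i * a k)"
    using le by (intro sum_mono mult_le_mono) auto
  also have "\<dots> = (\<Sum>i=1..k. c i) * a k" by (simp add: sum_distrib_right)
  also have "\<dots> \<le> h * a k" using c(2) by simp
  finally show ?thesis by simp
qed

lemma h_range_properties:
  assumes "is_basis a k"
  shows "\<forall>y\<le>h_range a k h. has_rep a k h (int y)"
    and "(\<forall>y\<le>n. has_rep a k h (int y)) \<Longrightarrow> n \<le> h_range a k h"
proof -
  let ?P = "\<lambda>n. \<forall>y\<le>n. has_rep a k h (int y)"
  have "?P 0" by (auto simp: has_rep_def intro!: exI[of _ "\<lambda>_. 0"])
  moreover have b: "n \<le> h * a k" if "?P n" for n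
    using has_rep_le[OF assms, of h "int n"] that zle_int by blast
  ultimately show "?P (h_range a k h)"
    unfolding h_range_def using GreatestI_nat[of ?P 0 "h * a k"] by blast
  show "n \<le> h_range a k h" if "?P n"
    unfolding h_range_def using that b by (intro Greatest_le_nat[of ?P n "h * a k"]) auto
qed

lemma h_zero_properties:
  assumes "is_basis a k"
  shows "0 < h_zero a k" and "a k \<le> h_range a k (h_zero a k)"
proof -
  have k: "1 \<le> k" "a 1 = 1" using assms by (auto simp: is_basis_def)
  have "has_rep a k (a k) (int y)" if "y \<le> a k" for y
  proof -
    let ?c = "\<lambda>i::nat. if i = 1 then y else 0"
    have "(\<Sum>i=1..k. int (?c i) * int (a i)) = (\<Sum>i=1..k. if i = 1 then int y else 0)"
      using k by (intro sum.cong) auto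
    then show ?thesis unfolding has_rep_def using k that
      by (intro exI[of _ ?c]) simp
  qed
  then have "a k \<le> h_range a k (a k)" by (intro h_range_properties(2)[OF assms]) blast
  moreover have "0 < a k"
    using assms strict_mono_on_leD[of "{1..k}" a 1 k] by (auto simp: is_basis_def)
  ultimately have "\<exists>h. 0 < h \<and> a k \<le> h_range a k h" by blast
  from LeastI_ex[OF this] show "0 < h_zero a k" and "a k \<le> h_range a k (h_zero a k)"
    by (auto simp: h_zero_def)
qed

end

theory Submission
  imports Defs
begin

text \<open>
  For \<open>x' = x + a\<^sub>k - a\<^sub>i\<close> one has \<open>x'\<^sub>m = x\<^sub>m\<^sub>+\<^sub>1 - a\<^sub>i\<close>. Adding one summand \<open>a\<^sub>i\<close> to an
  \<open>m\<close>-representation of \<open>x'\<^sub>m\<close> therefore represents \<open>x\<^sub>m\<^sub>+\<^sub>1\<close>, which is impossible for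
  \<open>m + 1 < h\<close>, while removing one summand \<open>a\<^sub>i\<close> from the given representation of \<open>x\<^sub>h\<close>
  represents \<open>x'\<^sub>h\<^sub>-\<^sub>1\<close>.
\<close>

lemma shift_add_difference:
  "shift a k (x + (int (a k) - b)) m = shift a k x (m + 1) - b"
  by (simp add: shift_def algebra_simps)

text \<open>Used in both directions: to add a summand \<open>a i\<close> to a representation and,
  once the given coefficients are written as an update, to remove one.\<close>

lemma sum_fun_upd_Suc:
  fixes c :: "nat \<Rightarrow> nat"
  assumes "finite I" "i \<in> I"
  shows "(\<Sum>j\<in>I. int ((c(i := Suc (c i))) j) * int (a j)) = (\<Sum>j\<in>I. int (c j) * int (a j)) + int (a i)"
    and "(\<Sum>j\<in>I. (c(i := Suc (c i))) j) = Suc (\<Sum>j\<in>I. c j)"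
  using assms by (simp_all add: sum.remove[of I i] algebra_simps)

lemma has_rep_add_element:
  assumes "has_rep a k h y" "i \<in> {1..k}"
  shows "has_rep a k (Suc h) (y + int (a i))"
proof -
  obtain c :: "nat \<Rightarrow> nat" where "y = (\<Sum>j=1..k. int (c j) * int (a j))" "(\<Sum>j=1..k. c j) \<le> h"
    using assms(1) by (auto simp: has_rep_def)
  then show ?thesis
    unfolding has_rep_def using assms(2)
    by (intro exI[of _ "c(i := Suc (c i))"]) (simp only: sum_fun_upd_Suc finite_atLeastAtMost, simp)
qed

text \<open>Padding with zero coefficients beyond \<open>l\<close> changes neither sum.\<close>

lemma has_rep_initial_segment:
  assumes "l \<le> k" "(\<Sum>j=1..l. c j) \<le> h"
  shows "has_rep a k h (\<Sum>j=1..l. int (c j) * int (a j))"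
proof -
  let ?d = "\<lambda>j. if j \<le> l then c j else 0"
  have "(\<Sum>j=1..k. int (?d j) * int (a j)) = (\<Sum>j=1..l. int (c j) * int (a j))"
    "(\<Sum>j=1..k. ?d j) = (\<Sum>j=1..l. c j)"
    using assms(1) by (auto intro!: sum.mono_neutral_cong_right)
  then show ?thesis
    unfolding has_rep_def using assms(2) by (intro exI[of _ ?d]) simp
qed

theorem theorem5:
  fixes a :: "nat \<Rightarrow> nat" and k h :: nat and x :: int and c :: "nat \<Rightarrow> nat"
  assumes "is_basis a k"
    and "h_zero a k + 1 \<le> h"
    and "is_gap a k h x"
    and "shift a k x (int h) = (\<Sum>i=1..k-1. int (c i) * int (a i))"
    and "(\<Sum>i=1..k-1. c i) \<le> h"
  shows "\<forall>i\<in>{1..k-1}. c i > 0 \<longrightarrow> is_gap a k (h - 1) (x + (int (a k) - int (a i)))"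
proof (intro ballI impI)
  fix i assume i: "i \<in> {1..k-1}" and "c i > 0"
  then have "i \<in> {1..k}"
    by auto
  let ?x = "x + (int (a k) - int (a i))"
  \<comment> \<open>Hence \<open>?x\<close> exceeds \<open>x\<close> and inherits its lower
    bound.\<close>
  have "a i < a k"
    using assms(1) i by (auto simp: is_basis_def intro!: strict_mono_onD[of "{1..k}" a])
  then have large: "int (h_range a k (h_zero a k - 1)) < ?x"
    using assms(3) by (simp add: is_gap_def)
  have no_rep: "\<not> has_rep a k m (shift a k ?x (int m))" if "h_zero a k - 1 \<le> m" "m < h - 1" for m
  proof
    assume "has_rep a k m (shift a k ?x (int m))"
    from has_rep_add_element[OF this \<open>i \<in> {1..k}\<close>]
    have "has_rep a k (Suc m) (shift a k x (int (Suc m)))"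
      by (simp add: shift_add_difference add.commute)
    moreover have "h_zero a k - 1 \<le> Suc m" "Suc m < h"
      using that by simp_all
    ultimately show False
      using assms(3) unfolding is_gap_def by blast
  qed
  \<comment> \<open>Since \<open>c i > 0\<close>, the truncated subtraction is exact and
    \<open>c\<close> is recovered from \<open>d\<close> by one increment.\<close>
  define d where "d = c(i := c i - 1)"
  have c: "c = d(i := Suc (d i))"
    using \<open>c i > 0\<close> by (auto simp: d_def)
  have "shift a k x (int h) = (\<Sum>j=1..k-1. int (d j) * int (a j)) + int (a i)"
    "Suc (\<Sum>j=1..k-1. d j) \<le> h"
    using assms(4,5) sum_fun_upd_Suc[of "{1..k-1}" i d] i unfolding c[symmetric] by simp_all
  moreover have "int (h - 1) + 1 = int h"
    using assms(2) by simp
  ultimately have "has_rep a k (h - 1) (shift a k ?x (int (h - 1)))"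
    using has_rep_initial_segment[of "k - 1" k d "h - 1" a] by (simp only: shift_add_difference) simp
  \<comment> \<open>The bound \<open>h_zero a k + 1 \<le> h\<close> makes \<open>h - 1\<close> large
    enough to be the order of a gap.\<close>
  then show "is_gap a k (h - 1) ?x"
    unfolding is_gap_def using assms(2) large no_rep by simp
qed

end
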